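(* Let $\Psi:\mathbb{R}^n\to\mathbb{R}\cup\{\infty\}$ be proper, closed and convex, and $B\succ0$. For all $x,g,e\in\mathbb{R}^n$ and $\delta\ge0$, $$\mathrm{Prox}_\Psi^B(x,g+e,\delta)\subseteq\mathrm{Prox}_\Psi^B\left(x,g,\ \delta+\sqrt{2\delta}\,\|e\|_B^*+\tfrac12\left(\|e\|_B^*\right)^2\right).$$
   Context: $\langle\cdot,\cdot\rangle$ is an inner product on $\mathbb{R}^n$; for $B\in\mathbb{R}^{n\times n}$ positive definite (written $B\succ0$; self-adjoint), $\|\cdot\|_B$ is the norm induced by $(x,y)\mapsto\langle Bx,y\rangle$ and $\|\cdot\|_B^*=\|\cdot\|_{B^{-1}}$ is its dual norm. The inexact pre-conditioned proximal map is the set $$\mathrm{Prox}^B_\Psi(x,g,\delta)=\left\{y:\langle g,y\rangle+\tfrac12\|y-x\|_B^2+\Psi(y)\le\min_{z\in\mathbb{R}^n}\left\{\langle g,z\rangle+\tfrac12\|z-x\|_B^2+\Psi(z)\right\}+\delta\right\}.$$ *)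

theory Defs
  imports "HOL-Analysis.Analysis"
begin

text \<open>The inner product is an arbitrary one on \<open>real ^ 'n\<close>, not necessarily the standard
  one, so it is a parameter \<open>ip\<close> throughout; self-adjointness and positive definiteness of
  matrices refer to it.\<close>

definition inner_product :: "('a::real_vector \<Rightarrow> 'a \<Rightarrow> real) \<Rightarrow> bool" where
  "inner_product ip \<longleftrightarrow>
     bilinear ip \<and> (\<forall>x y. ip x y = ip y x) \<and> (\<forall>x. x \<noteq> 0 \<longrightarrow> ip x x > 0)"

definition pos_def_mat :: "(real^'n \<Rightarrow> real^'n \<Rightarrow> real) \<Rightarrow> real^'n^'n \<Rightarrow> bool" where
  "pos_def_mat ip B \<longleftrightarrow>
     (\<forall>x y. ip (B *v x) y = ip x (B *v y)) \<and> (\<forall>x. x \<noteq> 0 \<longrightarrow> ip (B *v x) x > 0)"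

definition mat_norm :: "(real^'n \<Rightarrow> real^'n \<Rightarrow> real) \<Rightarrow> real^'n^'n \<Rightarrow> real^'n \<Rightarrow> real" where
  "mat_norm ip B x = sqrt (ip (B *v x) x)"

definition dual_mat_norm :: "(real^'n \<Rightarrow> real^'n \<Rightarrow> real) \<Rightarrow> real^'n^'n \<Rightarrow> real^'n \<Rightarrow> real" where
  "dual_mat_norm ip B = mat_norm ip (matrix_inv B)"

text \<open>Functions into \<open>\<real> \<union> {\<infinity>}\<close> are rendered as \<open>ereal\<close>-valued functions;
  \<open>proper\<close> contains the exclusion of \<open>-\<infinity>\<close>. The library constant \<open>epigraph\<close> covers only
  real-valued functions. As usual, the epigraph contains only points of finite height.\<close>

definition ereal_epigraph :: "('a \<Rightarrow> ereal) \<Rightarrow> ('a \<times> real) set" where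
  "ereal_epigraph \<Psi> = {(x, t). \<Psi> x \<le> ereal t}"

definition proper :: "('a \<Rightarrow> ereal) \<Rightarrow> bool" where
  "proper \<Psi> \<longleftrightarrow> (\<forall>x. \<Psi> x \<noteq> -\<infinity>) \<and> (\<exists>x. \<Psi> x \<noteq> \<infinity>)"

definition closed_fun :: "('a::topological_space \<Rightarrow> ereal) \<Rightarrow> bool" where
  "closed_fun \<Psi> \<longleftrightarrow> closed (ereal_epigraph \<Psi>)"

definition convex_fun :: "('a::real_vector \<Rightarrow> ereal) \<Rightarrow> bool" where
  "convex_fun \<Psi> \<longleftrightarrow> convex (ereal_epigraph \<Psi>)"

definition prox_objective ::
  "(real^'n \<Rightarrow> real^'n \<Rightarrow> real) \<Rightarrow> real^'n^'n \<Rightarrow> (real^'n \<Rightarrow> ereal) \<Rightarrow> real^'n \<Rightarrow> real^'n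
     \<Rightarrow> real^'n \<Rightarrow> ereal" where
  "prox_objective ip B \<Psi> x g z =
     ereal (ip g z + 1/2 * (mat_norm ip B (z - x))\<^sup>2) + \<Psi> z"

text \<open>The minimum is a genuine one, attained at some \<open>m\<close>, and not merely an infimum.\<close>

definition inexact_prox ::
  "(real^'n \<Rightarrow> real^'n \<Rightarrow> real) \<Rightarrow> real^'n^'n \<Rightarrow> (real^'n \<Rightarrow> ereal) \<Rightarrow> real^'n \<Rightarrow> real^'n
     \<Rightarrow> real \<Rightarrow> (real^'n) set" where
  "inexact_prox ip B \<Psi> x g \<delta> =
     {y. \<exists>m. is_arg_min (prox_objective ip B \<Psi> x g) (\<lambda>_. True) m \<and>
             prox_objective ip B \<Psi> x g y \<le> prox_objective ip B \<Psi> x g m + ereal \<delta>}"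

end

theory Submission
  imports Defs
begin

text \<open>Let \<open>m\<close> minimize the objective \<open>F'\<close> with linear term \<open>g + e\<close>. Strong convexity gives
  \<open>F' z \<ge> F' m + 1/2 \<parallel>z - m\<parallel>\<^sub>B\<^sup>2\<close>. Hence the objective \<open>F = F' - \<langle>e, \<cdot>\<rangle>\<close> is coercive and
  has a minimizer \<open>m'\<close>, and every \<open>y\<close> with \<open>F' y \<le> F' m + \<delta>\<close> satisfies
  \<open>\<parallel>y - m\<parallel>\<^sub>B \<le> sqrt (2 \<delta>)\<close>. Using the growth bound at \<open>m'\<close> as well,
  \<open>F y - F m' \<le> \<delta> - \<langle>e, y - m\<rangle> + (\<langle>e, m' - m\<rangle> - 1/2 \<parallel>m' - m\<parallel>\<^sub>B\<^sup>2)\<close>;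
  Cauchy-Schwarz bounds the second term and Young's inequality the third. Extended values are
  avoided by minimizing \<open>q z + t\<close> over the points \<open>(z, t)\<close> of the epigraph.\<close>

lemma bilinear_form_quadratic:
  fixes b :: "'a::real_vector \<Rightarrow> 'a \<Rightarrow> real"
  assumes b: "bilinear b" and sym: "\<And>u v. b u v = b v u"
  shows "b (u + s *\<^sub>R v) (u + s *\<^sub>R v) = b u u + 2 * s * b u v + s\<^sup>2 * b v v"
  using sym[of v u]
  by (simp add: bilinear_ladd[OF b] bilinear_radd[OF b] bilinear_lmul[OF b] bilinear_rmul[OF b]
      power2_eq_square algebra_simps)

lemma bilinear_form_Cauchy_Schwarz:
  fixes b :: "'a::real_vector \<Rightarrow> 'a \<Rightarrow> real"
  assumes b: "bilinear b" and sym: "\<And>u v. b u v = b v u"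
    and pos: "\<And>v. v \<noteq> 0 \<Longrightarrow> b v v > 0"
  shows "\<bar>b u v\<bar> \<le> sqrt (b u u) * sqrt (b v v)"
proof (cases "v = 0")
  case True
  then show ?thesis using bilinear_rzero[OF b] by simp
next
  case False
  have nonneg: "b w w \<ge> 0" for w
    using pos[of w] bilinear_rzero[OF b] by (cases "w = 0") auto
  \<comment> \<open>The coefficient \<open>- (b u v / b v v)\<close> minimizes the quadratic
    polynomial \<open>s \<mapsto> b (u + s *\<^sub>R v) (u + s *\<^sub>R v)\<close>.\<close>
  have "0 \<le> b (u + (- (b u v / b v v)) *\<^sub>R v) (u + (- (b u v / b v v)) *\<^sub>R v)"
    by (rule nonneg)
  also have "\<dots> = b u u - (b u v)\<^sup>2 / b v v"
    using pos[OF False]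
    by (subst bilinear_form_quadratic[OF b sym]) (simp add: field_simps power2_eq_square)
  finally have "(b u v)\<^sup>2 \<le> b u u * b v v"
    using pos[OF False] by (simp add: field_simps)
  then have "sqrt ((b u v)\<^sup>2) \<le> sqrt (b u u * b v v)" by (rule real_sqrt_le_mono)
  then show ?thesis by (simp add: real_sqrt_mult)
qed

text \<open>The constant is the minimum of \<open>b v v\<close> on the compact unit sphere;
  homogeneity of degree two carries the bound to all vectors.\<close>

lemma bilinear_form_coercive:
  fixes b :: "'a::euclidean_space \<Rightarrow> 'a \<Rightarrow> real"
  assumes b: "bilinear b" and pos: "\<And>v. v \<noteq> 0 \<Longrightarrow> b v v > 0"
  obtains c where "c > 0" "\<And>v. c * (norm v)\<^sup>2 \<le> b v v"
proof -
  have cont: "continuous_on (sphere 0 1) (\<lambda>v. b v v)"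
    by (intro bilinear_continuous_on_compose[OF _ _ b] continuous_on_id)
  have "sphere (0::'a) 1 \<noteq> {}" by simp
  from continuous_attains_inf[OF compact_sphere this cont]
  obtain w where w: "norm w = 1" and min: "\<And>v. norm v = 1 \<Longrightarrow> b w w \<le> b v v"
    by auto
  have "b w w * (norm v)\<^sup>2 \<le> b v v" for v
  proof (cases "v = 0")
    case True
    then show ?thesis using bilinear_rzero[OF b] by simp
  next
    case False
    then have "b w w \<le> b (v /\<^sub>R norm v) (v /\<^sub>R norm v)" by (intro min) simp
    also have "\<dots> = b v v / (norm v)\<^sup>2"
      by (simp add: bilinear_lmul[OF b] bilinear_rmul[OF b] power2_eq_square field_simps)
    finally show ?thesis using False by (simp add: field_simps)
  qed
  moreover have "b w w > 0" using w by (intro pos) auto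
  ultimately show ?thesis using that by blast
qed

text \<open>Along the segment from \<open>(m, \<tau>)\<close> to \<open>(z, t)\<close>, which stays
  in \<open>S\<close> by convexity, the objective is a quadratic polynomial in \<open>s\<close>.
  Minimality at \<open>s = 0\<close> makes its slope there nonnegative, so at \<open>s = 1\<close>
  at least the second-order term is gained.\<close>

lemma quadratic_growth_at_minimizer:
  fixes b :: "'a::real_vector \<Rightarrow> 'a \<Rightarrow> real"
  assumes b: "bilinear b" and sym: "\<And>u v. b u v = b v u" and l: "linear l"
    and q: "\<And>z. q z = l z + 1/2 * b (z - x) (z - x)"
    and S: "convex S" "(m, \<tau>) \<in> S" "(z, t) \<in> S"
    and min: "\<And>y s. (y, s) \<in> S \<Longrightarrow> q m + \<tau> \<le> q y + s"
  shows "q m + \<tau> + 1/2 * b (z - m) (z - m) \<le> q z + t"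
proof -
  \<comment> \<open>\<open>A\<close> is the first and \<open>D\<close> the second derivative at
    \<open>s = 0\<close> of the objective along the segment.\<close>
  define A where "A = l (z - m) + b (m - x) (z - m) + (t - \<tau>)"
  define D where "D = b (z - m) (z - m)"
  have expand: "q (m + s *\<^sub>R (z - m)) = q m + s * (A - (t - \<tau>)) + s\<^sup>2 / 2 * D" for s
  proof -
    have "m + s *\<^sub>R (z - m) - x = (m - x) + s *\<^sub>R (z - m)" by simp
    then show ?thesis
      unfolding q A_def D_def
      by (simp only: bilinear_form_quadratic[OF b sym] linear_add[OF l] linear_scale[OF l])
        (simp add: algebra_simps)
  qed
  have pos: "0 \<le> A + s / 2 * D" if s: "0 < s" "s \<le> 1" for s
  proof -
    have "(1 - s) *\<^sub>R (m, \<tau>) + s *\<^sub>R (z, t) \<in> S"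
      using convexD_alt[OF S] s by simp
    moreover have "(1 - s) *\<^sub>R (m, \<tau>) + s *\<^sub>R (z, t) = (m + s *\<^sub>R (z - m), \<tau> + s * (t - \<tau>))"
      by (simp add: algebra_simps)
    ultimately have "q m + \<tau> \<le> q (m + s *\<^sub>R (z - m)) + (\<tau> + s * (t - \<tau>))"
      using min by simp
    then have "0 \<le> s * (A + s / 2 * D)"
      unfolding expand by (simp add: algebra_simps power2_eq_square)
    then show ?thesis using s by (simp add: zero_le_mult_iff)
  qed
  \<comment> \<open>The factor \<open>s\<close> has been divided out, so the limit
    \<open>s \<rightarrow> 0\<close> from the right leaves \<open>0 \<le> A\<close>.\<close>
  have "((\<lambda>s. A + s / 2 * D) \<longlongrightarrow> A + 0 / 2 * D) (at_right 0)"
    by (intro tendsto_intros) auto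
  moreover have "eventually (\<lambda>s. 0 \<le> A + s / 2 * D) (at_right (0::real))"
    unfolding eventually_at_right_field using pos by (intro exI[of _ 1]) auto
  ultimately have "0 \<le> A + 0 / 2 * D"
    by (intro tendsto_lowerbound) auto
  then show ?thesis using expand[of 1] by (simp add: D_def)
qed

text \<open>Quadratic growth dominates the linear term \<open>k\<close>, so a sublevel set of the
  perturbed objective in \<open>S\<close> is compact and the minimum over it is attained.\<close>

lemma minimizer_of_linear_perturbation:
  fixes b :: "'a::euclidean_space \<Rightarrow> 'a \<Rightarrow> real" and q :: "'a \<Rightarrow> real"
  assumes b: "bilinear b" and pos: "\<And>v. v \<noteq> 0 \<Longrightarrow> b v v > 0"
    and q: "continuous_on UNIV q" and k: "linear k"
    and S: "closed S" "(m, \<tau>) \<in> S"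
    and growth: "\<And>z t. (z, t) \<in> S \<Longrightarrow> q m + \<tau> + 1/2 * b (z - m) (z - m) \<le> q z + t"
  obtains m' \<tau>' where "(m', \<tau>') \<in> S"
    "\<And>z t. (z, t) \<in> S \<Longrightarrow> q m' - k m' + \<tau>' \<le> q z - k z + t"
proof -
  obtain c where c: "c > 0" "\<And>v. c * (norm v)\<^sup>2 \<le> b v v"
    using bilinear_form_coercive[OF b pos] by blast
  obtain K where K: "K > 0" "\<And>v. norm (k v) \<le> K * norm v"
    using linear_bounded_pos[OF k] by blast
  have kcont: "continuous_on A k" for A
    using k by (rule linear_continuous_on[OF linear_conv_bounded_linear[THEN iffD1]])
  define h where "h = (\<lambda>p::'a \<times> real. q (fst p) - k (fst p) + snd p)"
  \<comment> \<open>On \<open>T\<close>, growth and the sublevel condition give \<open>c / 2 * (norm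
    (z - m))\<^sup>2 \<le> k (z - m) \<le> K * norm (z - m)\<close>, which yields this
    radius.\<close>
  define R where "R = 2 * K / c"
  define T where "T = {p \<in> S. h p \<le> h (m, \<tau>)}"
  have qc: "continuous_on A q" for A by (rule continuous_on_subset[OF q]) simp
  have hcont: "continuous_on A h" for A
    unfolding h_def
    by (intro continuous_intros continuous_on_compose2[OF q] continuous_on_compose2[OF kcont])
      auto
  have "compact (q ` cball m R)" "compact (k ` cball m R)"
    by (intro compact_continuous_image qc kcont compact_cball)+
  then obtain Q L where Q: "\<And>z. z \<in> cball m R \<Longrightarrow> \<bar>q z\<bar> \<le> Q"
    and L: "\<And>z. z \<in> cball m R \<Longrightarrow> \<bar>k z\<bar> \<le> L"
    using bounded_iff compact_imp_bounded
    by (metis (no_types, lifting) image_eqI real_norm_def)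
  \<comment> \<open>The heights also need bounds: the lower one comes from growth, the upper one
    from the sublevel condition.\<close>
  have "T \<subseteq> cball m R \<times> {q m + \<tau> - Q .. h (m, \<tau>) + Q + L}"
  proof (safe)
    fix z t assume zt: "(z, t) \<in> T"
    then have gr: "q m + \<tau> + 1/2 * b (z - m) (z - m) \<le> q z + t"
      and le: "h (z, t) \<le> h (m, \<tau>)"
      using growth unfolding T_def by auto
    have "k z - k m \<le> K * norm (z - m)"
      using K(2)[of "z - m"] by (simp add: linear_diff[OF k])
    then have "c * norm (z - m) * norm (z - m) \<le> 2 * K * norm (z - m)"
      using gr le c(2)[of "z - m"] by (simp add: h_def power2_eq_square)
    then have "c * norm (z - m) \<le> 2 * K"
      using K(1) by (cases "z = m") auto
    then show z: "z \<in> cball m R"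
      using c(1) by (simp add: R_def dist_norm norm_minus_commute field_simps)
    have "b (z - m) (z - m) \<ge> 0"
      using c(1) c(2)[of "z - m"] by (smt (verit) mult_nonneg_nonneg zero_le_power2)
    then show "t \<in> {q m + \<tau> - Q .. h (m, \<tau>) + Q + L}"
      using gr le Q[OF z] L[OF z] by (auto simp: h_def)
  qed
  then have "bounded T"
    by (rule bounded_subset[rotated]) (intro bounded_Times bounded_cball bounded_closed_interval)
  moreover have "closed T"
    unfolding T_def
    by (rule closed_Collect_conj[of "\<lambda>p. p \<in> S", simplified])
      (use S in \<open>auto intro!: closed_Collect_le hcont continuous_intros\<close>)
  ultimately have "compact T" by (simp add: compact_eq_bounded_closed)
  moreover have mT: "(m, \<tau>) \<in> T" using S by (simp add: T_def)
  ultimately obtain p where p: "p \<in> T" "\<And>r. r \<in> T \<Longrightarrow> h p \<le> h r"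
    using continuous_attains_inf[of T h] hcont by blast
  \<comment> \<open>Points of \<open>S\<close> outside \<open>T\<close> have a larger value than
    \<open>(m, \<tau>)\<close>, which itself lies in \<open>T\<close>.\<close>
  have "h p \<le> h r" if "r \<in> S" for r
    using p(2)[of r] p(2)[OF mT] that unfolding T_def by force
  then show ?thesis
    using p(1) that[of "fst p" "snd p"] by (force simp: T_def h_def)
qed

text \<open>This passes to real arithmetic: properness supplies a point of finite value, so the
  minimum is finite, and points where \<open>\<Psi>\<close> is infinite have nothing above them in
  the epigraph.\<close>

lemma is_arg_min_epigraph:
  assumes "proper \<Psi>"
  shows "is_arg_min (\<lambda>z. ereal (q z) + \<Psi> z) (\<lambda>_. True) m \<longleftrightarrow>
    (\<exists>\<tau>. \<Psi> m = ereal \<tau> \<and> (\<forall>z t. (z, t) \<in> ereal_epigraph \<Psi> \<longrightarrow> q m + \<tau> \<le> q z + t))"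
    (is "?min \<longleftrightarrow> ?epi")
proof
  assume min: ?min
  then have le: "ereal (q m) + \<Psi> m \<le> ereal (q z) + \<Psi> z" for z
    by (auto simp: is_arg_min_def not_less)
  obtain w where "\<Psi> w \<noteq> \<infinity>" "\<Psi> w \<noteq> - \<infinity>" using assms by (auto simp: proper_def)
  moreover have "\<Psi> m \<noteq> - \<infinity>" using assms by (simp add: proper_def)
  ultimately obtain \<tau> where \<tau>: "\<Psi> m = ereal \<tau>"
    using le[of w] by (cases "\<Psi> m"; cases "\<Psi> w") auto
  have "q m + \<tau> \<le> q z + t" if "\<Psi> z \<le> ereal t" for z t
  proof -
    have "ereal (q m) + ereal \<tau> \<le> ereal (q z) + ereal t"
      using le[of z] \<tau> that by (metis add_left_mono order_trans)
    then show ?thesis by simp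
  qed
  with \<tau> show ?epi by (auto simp: ereal_epigraph_def)
next
  assume ?epi
  then obtain \<tau> where \<tau>: "\<Psi> m = ereal \<tau>"
    and le: "\<And>z t. \<Psi> z \<le> ereal t \<Longrightarrow> q m + \<tau> \<le> q z + t"
    by (auto simp: ereal_epigraph_def)
  have "ereal (q m) + \<Psi> m \<le> ereal (q z) + \<Psi> z" for z
    using assms le[of z] \<tau> by (cases "\<Psi> z") (auto simp: proper_def)
  then show ?min by (auto simp: is_arg_min_def not_less)
qed

text \<open>Positive definiteness makes the kernel of \<open>B\<close> trivial. Invertibility has to
  come first because \<open>matrix_inv\<close> is defined by choice.\<close>

lemma pos_def_mat_inv_right:
  assumes ip: "inner_product ip" and B: "pos_def_mat ip B"
  shows "B *v (matrix_inv B *v v) = v"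
proof -
  have "u = 0" if "B *v u = 0" for u
  proof (rule ccontr)
    assume "u \<noteq> 0"
    then have "ip (B *v u) u > 0" using B unfolding pos_def_mat_def by blast
    moreover have "ip 0 u = 0"
      using ip bilinear_lzero by (auto simp: inner_product_def)
    ultimately show False using that by simp
  qed
  then have "invertible B"
    using matrix_left_invertible_ker invertible_left_inverse by blast
  then have "\<exists>A'. B ** A' = mat 1 \<and> A' ** B = mat 1"
    unfolding invertible_def .
  then have "B ** matrix_inv B = mat 1 \<and> matrix_inv B ** B = mat 1"
    unfolding matrix_inv_def by (rule someI_ex)
  then show ?thesis
    by (simp add: matrix_vector_mul_assoc)
qed

theorem corollary3p3p4:
  fixes ip :: "real^'n \<Rightarrow> real^'n \<Rightarrow> real"
    and B :: "real^'n^'n"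
    and \<Psi> :: "real^'n \<Rightarrow> ereal"
    and x g e :: "real^'n"
    and \<delta> :: real
  assumes "inner_product ip"
    and "pos_def_mat ip B"
    and "proper \<Psi>" and "closed_fun \<Psi>" and "convex_fun \<Psi>"
    and "\<delta> \<ge> 0"
  shows "inexact_prox ip B \<Psi> x (g + e) \<delta> \<subseteq>
         inexact_prox ip B \<Psi> x g
           (\<delta> + sqrt (2 * \<delta>) * dual_mat_norm ip B e + 1/2 * (dual_mat_norm ip B e)\<^sup>2)"
proof
  define b where "b = (\<lambda>u v. ip (B *v u) v)"
  have ip: "bilinear ip" and ip_sym: "\<And>u v. ip u v = ip v u"
    using assms(1) by (auto simp: inner_product_def)
  have b: "bilinear b"
    using ip unfolding b_def bilinear_def
    by (auto intro: linear_compose[OF matrix_vector_mul_linear, unfolded o_def])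
  have sym: "b u v = b v u" for u v
    using assms(2) ip_sym by (simp add: b_def pos_def_mat_def)
  have pos: "b v v > 0" if "v \<noteq> 0" for v
    using assms(2) that unfolding b_def pos_def_mat_def by blast
  have nonneg: "b v v \<ge> 0" for v
    using pos[of v] bilinear_rzero[OF b] by (cases "v = 0") auto
  have lin: "linear (ip a)" for a using ip by (simp add: bilinear_def)
  \<comment> \<open>\<open>w\<close> represents the functional \<open>ip e\<close> with respect to
    \<open>b\<close>, and the squared dual norm of \<open>e\<close> is \<open>b w w\<close>; only
    the form \<open>b\<close> remains to be handled.\<close>
  define w where "w = matrix_inv B *v e"
  have ip_e: "ip e v = b w v" for v
    by (simp add: b_def w_def pos_def_mat_inv_right[OF assms(1,2)])
  have dual: "dual_mat_norm ip B e = sqrt (b w w)"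
    unfolding dual_mat_norm_def mat_norm_def
    by (simp add: ip_sym[of _ e] ip_e flip: w_def)
  define q where "q = (\<lambda>a z. ip a z + 1/2 * b (z - x) (z - x))"
  have obj: "prox_objective ip B \<Psi> x a = (\<lambda>z. ereal (q a z) + \<Psi> z)" for a
    using nonneg by (simp add: prox_objective_def fun_eq_iff q_def mat_norm_def b_def)
  have q_add: "q (g + e) z = q g z + ip e z" for z
    by (simp add: q_def bilinear_ladd[OF ip])
  have q_cont: "continuous_on UNIV (q a)" for a
    unfolding q_def using linear_continuous_on[of "ip a"] lin[of a]
    by (intro continuous_intros bilinear_continuous_on_compose[OF _ _ b])
      (auto simp: linear_conv_bounded_linear)

  fix y assume "y \<in> inexact_prox ip B \<Psi> x (g + e) \<delta>"
  then obtain m where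
    m: "is_arg_min (\<lambda>z. ereal (q (g + e) z) + \<Psi> z) (\<lambda>_. True) m"
    and y: "ereal (q (g + e) y) + \<Psi> y \<le> ereal (q (g + e) m) + \<Psi> m + ereal \<delta>"
    by (auto simp: inexact_prox_def obj)
  from m obtain \<tau> where \<tau>: "\<Psi> m = ereal \<tau>"
    and min: "\<And>z t. (z, t) \<in> ereal_epigraph \<Psi> \<Longrightarrow> q (g + e) m + \<tau> \<le> q (g + e) z + t"
    unfolding is_arg_min_epigraph[OF assms(3)] by blast
  have m_epi: "(m, \<tau>) \<in> ereal_epigraph \<Psi>" by (simp add: ereal_epigraph_def \<tau>)
  have growth: "q (g + e) m + \<tau> + 1/2 * b (z - m) (z - m) \<le> q (g + e) z + t"
    if "(z, t) \<in> ereal_epigraph \<Psi>" for z t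
    using assms(5) m_epi that min unfolding convex_fun_def
    by (intro quadratic_growth_at_minimizer[OF b sym lin[of "g + e"]]) (auto simp: q_def)
  from minimizer_of_linear_perturbation[OF b pos q_cont lin[of e]
      assms(4)[unfolded closed_fun_def] m_epi growth]
  obtain m' \<sigma> where m'_epi: "(m', \<sigma>) \<in> ereal_epigraph \<Psi>"
    and "\<And>z t. (z, t) \<in> ereal_epigraph \<Psi> \<Longrightarrow>
        q (g + e) m' - ip e m' + \<sigma> \<le> q (g + e) z - ip e z + t"
    by blast
  then have min': "q g m' + \<sigma> \<le> q g z + t" if "(z, t) \<in> ereal_epigraph \<Psi>" for z t
    using that by (simp add: q_add)
  \<comment> \<open>The height \<open>\<sigma>\<close> may exceed \<open>\<Psi> m'\<close>; it is
    lowered to the actual value \<open>\<tau>'\<close>.\<close>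
  have "\<Psi> m' \<noteq> - \<infinity>" using assms(3) by (simp add: proper_def)
  then obtain \<tau>' where \<tau>': "\<Psi> m' = ereal \<tau>'" "\<tau>' \<le> \<sigma>"
    using m'_epi by (cases "\<Psi> m'") (auto simp: ereal_epigraph_def)
  have m'_epi': "(m', \<tau>') \<in> ereal_epigraph \<Psi>" by (simp add: ereal_epigraph_def \<tau>')
  have "is_arg_min (\<lambda>z. ereal (q g z) + \<Psi> z) (\<lambda>_. True) m'"
    unfolding is_arg_min_epigraph[OF assms(3)] using \<tau>' min' by fastforce
  moreover have "ereal (q g y) + \<Psi> y \<le> ereal (q g m') + \<Psi> m' +
    ereal (\<delta> + sqrt (2 * \<delta>) * dual_mat_norm ip B e + 1/2 * (dual_mat_norm ip B e)\<^sup>2)"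
  proof -
    have "\<Psi> y \<noteq> - \<infinity>" using assms(3) by (simp add: proper_def)
    then obtain r where r: "\<Psi> y = ereal r"
      using y \<tau> by (cases "\<Psi> y") auto
    have y': "q (g + e) y + r \<le> q (g + e) m + \<tau> + \<delta>" using y \<tau> r by simp
    have "(y, r) \<in> ereal_epigraph \<Psi>" by (simp add: ereal_epigraph_def r)
    from growth[OF this] y' have "b (y - m) (y - m) \<le> 2 * \<delta>" by simp
    then have "sqrt (b w w) * sqrt (b (y - m) (y - m)) \<le> sqrt (b w w) * sqrt (2 * \<delta>)"
      by (intro mult_left_mono real_sqrt_le_mono) (use nonneg in auto)
    then have cs: "- ip e (y - m) \<le> sqrt (2 * \<delta>) * sqrt (b w w)"
      using bilinear_form_Cauchy_Schwarz[OF b sym pos, of w "y - m"]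
      by (simp add: ip_e mult.commute)
    \<comment> \<open>Young's inequality is nonnegativity of \<open>b\<close> at
      \<open>w - (m' - m)\<close>.\<close>
    have young: "ip e (m' - m) - 1/2 * b (m' - m) (m' - m) \<le> 1/2 * b w w"
      using nonneg[of "w + (- 1) *\<^sub>R (m' - m)"]
      unfolding bilinear_form_quadratic[OF b sym] ip_e by simp
    \<comment> \<open>Removing \<open>ip e\<close> from the two bounds leaves
      \<open>ip e (m' - y)\<close>, split at \<open>m\<close> into the terms bounded by
      \<open>young\<close> and \<open>cs\<close>.\<close>
    have "q g y + r \<le> q g m' + \<tau>' + (\<delta> + sqrt (2 * \<delta>) * sqrt (b w w) + 1/2 * b w w)"
      using growth[OF m'_epi'] y' cs young
      by (simp add: q_add linear_diff[OF lin])
    then show ?thesis using nonneg by (simp add: r \<tau>' dual)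
  qed
  ultimately show "y \<in> inexact_prox ip B \<Psi> x g
      (\<delta> + sqrt (2 * \<delta>) * dual_mat_norm ip B e + 1/2 * (dual_mat_norm ip B e)\<^sup>2)"
    unfolding inexact_prox_def obj by blast
qed

end
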